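(* If $G$ is a finitely generated residually finite group with trivial centre, then $\operatorname{Aut}\big(\operatorname{Conj}(G)\big)$ is a residually finite group.
   Context: A quandle is a non-empty set $X$ with a binary operation $*$ such that: (1) $x*x=x$ for all $x\in X$; (2) for all $x,y\in X$ there is a unique $z\in X$ with $x=z*y$; (3) $(x*y)*z=(x*z)*(y*z)$ for all $x,y,z\in X$. For a quandle $X$, $\operatorname{Aut}(X)$ is the group, under composition, of bijections $f:X\to X$ with $f(x*y)=f(x)*f(y)$ for all $x,y\in X$. For a group $G$, $\operatorname{Conj}(G)$ is the set $G$ with the quandle operation $a*b=b^{-1}ab$. A group $G$ is residually finite if for each $g\in G$, $g\ne1$, there are a finite group $F$ and a group homomorphism $\phi:G\to F$ with $\phi(g)\neq 1$. *)

theory Defs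
  imports "HOL-Algebra.Bij" "HOL-Algebra.Generated_Groups"
begin

subsection \<open>Quandles and their automorphism groups\<close>

record 'a quandle = "'a partial_object" +
  qop :: "['a, 'a] \<Rightarrow> 'a" (infixl \<open>\<star>\<index>\<close> 70)

locale quandle =
  fixes X (structure)
  assumes nonempty: "carrier X \<noteq> {}"
    and closed: "\<lbrakk>x \<in> carrier X; y \<in> carrier X\<rbrakk> \<Longrightarrow> x \<star> y \<in> carrier X"
    and idem: "x \<in> carrier X \<Longrightarrow> x \<star> x = x"
    and unique_div: "\<lbrakk>x \<in> carrier X; y \<in> carrier X\<rbrakk> \<Longrightarrow> \<exists>!z. z \<in> carrier X \<and> x = z \<star> y"
    and self_distrib: "\<lbrakk>x \<in> carrier X; y \<in> carrier X; z \<in> carrier X\<rbrakk>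
      \<Longrightarrow> (x \<star> y) \<star> z = (x \<star> z) \<star> (y \<star> z)"

text \<open>As in \<open>AutoGroup\<close>, automorphisms are extensional functions, so that each automorphism
  of the carrier is represented by exactly one function.\<close>

definition quandle_auto :: "('a, 'b) quandle_scheme \<Rightarrow> ('a \<Rightarrow> 'a) set" where
  "quandle_auto X = {f \<in> Bij (carrier X).
     \<forall>x\<in>carrier X. \<forall>y\<in>carrier X. f (x \<star>\<^bsub>X\<^esub> y) = f x \<star>\<^bsub>X\<^esub> f y}"

definition Aut_quandle :: "('a, 'b) quandle_scheme \<Rightarrow> ('a \<Rightarrow> 'a) monoid" where
  "Aut_quandle X = BijGroup (carrier X) \<lparr>carrier := quandle_auto X\<rparr>"

lemma (in quandle) subgroup_quandle_auto:
  "subgroup (quandle_auto X) (BijGroup (carrier X))"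
proof (rule subgroup.intro)
  show "quandle_auto X \<subseteq> carrier (BijGroup (carrier X))"
    by (auto simp: quandle_auto_def BijGroup_def)
next
  fix f g
  assume f: "f \<in> quandle_auto X" and g: "g \<in> quandle_auto X"
  then have "f \<in> Bij (carrier X)" "g \<in> Bij (carrier X)"
    by (auto simp: quandle_auto_def)
  moreover from this have "g x \<in> carrier X" if "x \<in> carrier X" for x
    using that Bij_imp_funcset by blast
  ultimately show "f \<otimes>\<^bsub>BijGroup (carrier X)\<^esub> g \<in> quandle_auto X"
    using f g by (auto simp: quandle_auto_def BijGroup_def compose_Bij compose_eq closed)
next
  show "\<one>\<^bsub>BijGroup (carrier X)\<^esub> \<in> quandle_auto X"
    by (auto simp: quandle_auto_def BijGroup_def id_Bij closed)
next
  fix f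
  assume f: "f \<in> quandle_auto X"
  then have B: "f \<in> Bij (carrier X)"
    by (simp add: quandle_auto_def)
  have "inv_into (carrier X) f (x \<star> y) = inv_into (carrier X) f x \<star> inv_into (carrier X) f y"
    if "x \<in> carrier X" "y \<in> carrier X" for x y
    using f that by (intro Bij_inv_into_lemma [OF _ B]) (auto simp: quandle_auto_def closed)
  then show "inv\<^bsub>BijGroup (carrier X)\<^esub> f \<in> quandle_auto X"
    using B by (auto simp: inv_BijGroup quandle_auto_def restrict_inv_into_Bij closed)
qed

lemma (in quandle) group_Aut_quandle: "group (Aut_quandle X)"
  by (simp add: Aut_quandle_def subgroup.subgroup_is_group subgroup_quandle_auto group_BijGroup)


subsection \<open>The conjugation quandle of a group\<close>

definition Conj :: "('a, 'b) monoid_scheme \<Rightarrow> 'a quandle" where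
  "Conj G = \<lparr>carrier = carrier G, qop = (\<lambda>a b. inv\<^bsub>G\<^esub> b \<otimes>\<^bsub>G\<^esub> a \<otimes>\<^bsub>G\<^esub> b)\<rparr>"

lemma (in group) quandle_Conj: "quandle (Conj G)"
proof
  fix x y
  assume "x \<in> carrier (Conj G)" "y \<in> carrier (Conj G)"
  then have x: "x \<in> carrier G" and y: "y \<in> carrier G"
    by (simp_all add: Conj_def)
  show "\<exists>!z. z \<in> carrier (Conj G) \<and> x = z \<star>\<^bsub>Conj G\<^esub> y"
  proof (rule ex1I [of _ "y \<otimes> x \<otimes> inv y"])
    show "y \<otimes> x \<otimes> inv y \<in> carrier (Conj G) \<and> x = (y \<otimes> x \<otimes> inv y) \<star>\<^bsub>Conj G\<^esub> y"
      using x y by (simp add: Conj_def m_assoc inv_solve_left)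
  next
    fix z
    assume "z \<in> carrier (Conj G) \<and> x = z \<star>\<^bsub>Conj G\<^esub> y"
    then show "z = y \<otimes> x \<otimes> inv y"
      using x y by (simp add: Conj_def m_assoc inv_solve_left)
        (simp add: m_assoc [symmetric])
  qed
next
  fix x y z
  assume "x \<in> carrier (Conj G)" "y \<in> carrier (Conj G)" "z \<in> carrier (Conj G)"
  then have c: "x \<in> carrier G" "y \<in> carrier G" "z \<in> carrier G"
    by (simp_all add: Conj_def)
  have cancel: "z \<otimes> (inv z \<otimes> w) = w" if "w \<in> carrier G" for w
    using c that by (simp add: m_assoc [symmetric])
  show "(x \<star>\<^bsub>Conj G\<^esub> y) \<star>\<^bsub>Conj G\<^esub> z = (x \<star>\<^bsub>Conj G\<^esub> z) \<star>\<^bsub>Conj G\<^esub> (y \<star>\<^bsub>Conj G\<^esub> z)"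
    using c by (simp add: Conj_def inv_mult_group m_assoc cancel)
qed (auto simp: Conj_def m_assoc [symmetric])


subsection \<open>Properties of groups\<close>

definition finitely_generated_group :: "('a, 'b) monoid_scheme \<Rightarrow> bool" where
  "finitely_generated_group G \<longleftrightarrow>
     group G \<and> (\<exists>S. finite S \<and> S \<subseteq> carrier G \<and> generate G S = carrier G)"

definition group_center :: "('a, 'b) monoid_scheme \<Rightarrow> 'a set" where
  "group_center G = {z \<in> carrier G. \<forall>g\<in>carrier G. z \<otimes>\<^bsub>G\<^esub> g = g \<otimes>\<^bsub>G\<^esub> z}"

text \<open>A definition cannot quantify over the type of the elements of the finite group.  Since every
  finite group is isomorphic to one whose elements are natural numbers, it is enough
  to let \<open>F\<close> range over the latter; \<open>residually_finiteI\<close> below shows that finite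
  groups over an arbitrary type may be used instead.\<close>

definition residually_finite :: "('a, 'b) monoid_scheme \<Rightarrow> bool" where
  "residually_finite G \<longleftrightarrow> group G \<and>
     (\<forall>g\<in>carrier G. g \<noteq> \<one>\<^bsub>G\<^esub> \<longrightarrow>
        (\<exists>(F :: nat monoid) \<phi>. group F \<and> finite (carrier F) \<and> \<phi> \<in> hom G F \<and> \<phi> g \<noteq> \<one>\<^bsub>F\<^esub>))"

lemma finite_group_nat_copy:
  fixes F :: "('c, 'd) monoid_scheme"
  assumes "group F" and "finite (carrier F)"
  obtains F' :: "nat monoid" and h where "group F'" "finite (carrier F')" "h \<in> iso F F'"
proof -
  interpret F: group F by fact
  obtain h :: "'c \<Rightarrow> nat" where inj: "inj_on h (carrier F)"
    using finite_imp_inj_to_nat_seg [OF assms(2)] by auto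
  define k where "k = inv_into (carrier F) h"
  have kh: "k (h x) = x" if "x \<in> carrier F" for x
    using that inj by (simp add: k_def)
  define F' where "F' = \<lparr>carrier = h ` carrier F, mult = (\<lambda>a b. h (k a \<otimes>\<^bsub>F\<^esub> k b)), one = h \<one>\<^bsub>F\<^esub>\<rparr>"
  have "group F'"
  proof (rule groupI)
    fix x assume "x \<in> carrier F'"
    then obtain a where a: "a \<in> carrier F" "x = h a"
      by (auto simp: F'_def)
    then show "\<exists>y\<in>carrier F'. y \<otimes>\<^bsub>F'\<^esub> x = \<one>\<^bsub>F'\<^esub>"
      by (intro bexI [of _ "h (inv\<^bsub>F\<^esub> a)"]) (auto simp: F'_def kh)
  qed (auto simp: F'_def kh F.m_assoc)
  moreover have "finite (carrier F')"
    using assms(2) by (simp add: F'_def)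
  moreover have "h \<in> iso F F'"
    using inj by (auto simp: iso_def hom_def bij_betw_def F'_def kh)
  ultimately show thesis
    by (rule that)
qed

lemma residually_finiteI:
  assumes "group G"
    and "\<And>g. \<lbrakk>g \<in> carrier G; g \<noteq> \<one>\<^bsub>G\<^esub>\<rbrakk> \<Longrightarrow>
      \<exists>(F :: 'c monoid) \<phi>. group F \<and> finite (carrier F) \<and> \<phi> \<in> hom G F \<and> \<phi> g \<noteq> \<one>\<^bsub>F\<^esub>"
  shows "residually_finite G"
  unfolding residually_finite_def
proof (intro conjI ballI impI)
  fix g assume g: "g \<in> carrier G" "g \<noteq> \<one>\<^bsub>G\<^esub>"
  then obtain F :: "'c monoid" and \<phi> where F: "group F" "finite (carrier F)"
    and \<phi>: "\<phi> \<in> hom G F" "\<phi> g \<noteq> \<one>\<^bsub>F\<^esub>"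
    using assms(2) by blast
  obtain F' :: "nat monoid" and h where F': "group F'" "finite (carrier F')" and h: "h \<in> iso F F'"
    using finite_group_nat_copy [OF F] .
  have hh: "h \<in> hom F F'" "inj_on h (carrier F)"
    using h by (auto simp: iso_def bij_betw_def)
  have "h \<circ> \<phi> \<in> hom G F'"
    using \<phi>(1) hh(1) by (auto simp: hom_def Pi_iff)
  moreover have "(h \<circ> \<phi>) g \<noteq> \<one>\<^bsub>F'\<^esub>"
  proof
    assume "(h \<circ> \<phi>) g = \<one>\<^bsub>F'\<^esub>"
    then have "h (\<phi> g) = h \<one>\<^bsub>F\<^esub>"
      using hom_one [OF hh(1) F(1) F'(1)] by simp
    moreover have "\<phi> g \<in> carrier F" "\<one>\<^bsub>F\<^esub> \<in> carrier F"
      using \<phi>(1) g(1) F(1) by (auto simp: hom_def group.is_monoid monoid.one_closed)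
    ultimately show False
      using hh(2) \<phi>(2) by (auto dest: inj_onD)
  qed
  ultimately show "\<exists>(F :: nat monoid) \<phi>. group F \<and> finite (carrier F) \<and> \<phi> \<in> hom G F \<and> \<phi> g \<noteq> \<one>\<^bsub>F\<^esub>"
    using F' by blast
qed (rule assms(1))

end

theory Submission
  imports Defs
begin

text \<open>If \<open>f\<close> is an automorphism of \<open>Conj G\<close>, then \<open>f (b c)\<close> and \<open>f b f c\<close> induce the same inner
  automorphism of \<open>G\<close>, so they agree when the centre is trivial and \<open>f\<close> is an automorphism of \<open>G\<close>.
  This leaves Baumslag's theorem that \<open>Aut G\<close> is residually finite.  For each finite \<open>F\<close>, a finitely
  generated \<open>G\<close> has only finitely many homomorphisms to \<open>F\<close>, and \<open>Aut G\<close> permutes them by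
  precomposition.  If \<open>\<beta> g \<noteq> g\<close>, then a homomorphism to a finite group that separates
  \<open>\<beta> g\<close> from \<open>g\<close> is moved by \<open>\<beta>\<close>.\<close>

text \<open>Treats a single \<open>g\<close>; once the hypothesis is known for every
  \<open>g\<close>, the element \<open>u \<otimes> inv v\<close> is central, so a trivial centre
  forces \<open>u = v\<close>.\<close>

lemma (in group) conj_eq_imp_mult_inv_commute:
  assumes "u \<in> carrier G" "v \<in> carrier G" "g \<in> carrier G"
    and "inv u \<otimes> g \<otimes> u = inv v \<otimes> g \<otimes> v"
  shows "u \<otimes> inv v \<otimes> g = g \<otimes> (u \<otimes> inv v)"
proof -
  have "g \<otimes> u = u \<otimes> (inv u \<otimes> g \<otimes> u)"
    using assms(1-3) by (simp add: m_assoc[symmetric])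
  also have "\<dots> = u \<otimes> (inv v \<otimes> g \<otimes> v)"
    by (simp only: assms(4))
  also have "\<dots> = u \<otimes> inv v \<otimes> g \<otimes> v"
    using assms(1-3) by (simp add: m_assoc)
  finally have "g \<otimes> u \<otimes> inv v = u \<otimes> inv v \<otimes> g \<otimes> v \<otimes> inv v"
    by simp
  then show ?thesis
    using assms(1-3) by (simp add: m_assoc)
qed

lemma (in group) quandle_auto_Conj:
  assumes "group_center G = {\<one>}"
  shows "quandle_auto (Conj G) = auto G"
proof (intro equalityI subsetI)
  fix f assume "f \<in> quandle_auto (Conj G)"
  then have B: "f \<in> Bij (carrier G)"
    and conj: "\<And>a b. \<lbrakk>a \<in> carrier G; b \<in> carrier G\<rbrakk>
      \<Longrightarrow> f (inv b \<otimes> a \<otimes> b) = inv (f b) \<otimes> f a \<otimes> f b"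
    by (auto simp: quandle_auto_def Conj_def)
  have f: "f x \<in> carrier G" if "x \<in> carrier G" for x
    using B that Bij_imp_funcset by blast
  have "f (b \<otimes> c) = f b \<otimes> f c" if b: "b \<in> carrier G" and c: "c \<in> carrier G" for b c
  proof -
    let ?z = "f (b \<otimes> c) \<otimes> inv (f b \<otimes> f c)"
    have "?z \<otimes> g = g \<otimes> ?z" if g: "g \<in> carrier G" for g
    proof -
      \<comment> \<open>Centrality has to be tested against every \<open>g\<close>, while
        \<open>conj\<close> only speaks of values of \<open>f\<close>; surjectivity of
        \<open>f\<close> closes the gap.\<close>
      obtain a where a: "a \<in> carrier G" "g = f a"
        using B g by (auto simp: Bij_def bij_betw_def)
      have "inv (f (b \<otimes> c)) \<otimes> f a \<otimes> f (b \<otimes> c) = f (inv (b \<otimes> c) \<otimes> a \<otimes> (b \<otimes> c))"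
        using a b c by (simp add: conj)
      \<comment> \<open>Conjugating by a product is conjugating twice, so \<open>conj\<close> can be
        used once for \<open>c\<close> and once for \<open>b\<close>.\<close>
      also have "\<dots> = f (inv c \<otimes> (inv b \<otimes> a \<otimes> b) \<otimes> c)"
        using a b c by (simp add: inv_mult_group m_assoc)
      also have "\<dots> = inv (f c) \<otimes> (inv (f b) \<otimes> f a \<otimes> f b) \<otimes> f c"
        using a b c by (simp add: conj)
      also have "\<dots> = inv (f b \<otimes> f c) \<otimes> f a \<otimes> (f b \<otimes> f c)"
        using a b c f by (simp add: inv_mult_group m_assoc)
      finally show ?thesis
        unfolding a(2) using a b c f by (intro conj_eq_imp_mult_inv_commute) simp_all
    qed
    then have "?z \<in> group_center G"
      using b c f by (simp add: group_center_def)
    then have "?z = \<one>"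
      using assms by simp
    then show ?thesis
      using b c f inv_solve_right'[of \<one> "f (b \<otimes> c)" "f b \<otimes> f c"] by simp
  qed
  then show "f \<in> auto G"
    using B f by (auto simp: auto_def hom_def)
next
  fix f assume f: "f \<in> auto G"
  then interpret f: group_hom G G f
    by (simp add: auto_def group_hom_def group_hom_axioms_def is_group)
  show "f \<in> quandle_auto (Conj G)"
    using f by (auto simp: auto_def quandle_auto_def Conj_def)
qed

lemma hom_eq_on_generate:
  assumes "group_hom G H f" "group_hom G H g" "S \<subseteq> carrier G"
    and "\<And>s. s \<in> S \<Longrightarrow> f s = g s" "x \<in> generate G S"
  shows "f x = g x"
proof -
  interpret f: group_hom G H f by fact
  interpret g: group_hom G H g by fact
  have in_G: "y \<in> carrier G" if "y \<in> generate G S" for y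
    using that assms(3) f.G.generate_in_carrier by blast
  from assms(5) show ?thesis
    by induction (use assms(3,4) in_G in \<open>auto simp: subset_iff\<close>)
qed

text \<open>A homomorphism is determined by its values on a finite generating set \<open>S\<close>,
  so restriction to \<open>S\<close> embeds these homomorphisms in the finite set of maps from
  \<open>S\<close> to \<open>F\<close>. Extensionality keeps one function per homomorphism, since
  values outside the carrier would otherwise be arbitrary.\<close>

lemma finite_hom_extensional:
  assumes "finitely_generated_group G" "group F" "finite (carrier F)"
  shows "finite (hom G F \<inter> extensional (carrier G))"
proof -
  from assms(1) obtain S where G: "group G" and S: "finite S" "S \<subseteq> carrier G" "generate G S = carrier G"
    by (auto simp: finitely_generated_group_def)
  let ?H = "hom G F \<inter> extensional (carrier G)"
  have "inj_on (\<lambda>\<phi>. restrict \<phi> S) ?H"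
  proof (rule inj_onI)
    fix \<phi> \<psi>
    assume \<phi>: "\<phi> \<in> ?H" and \<psi>: "\<psi> \<in> ?H" and eq: "restrict \<phi> S = restrict \<psi> S"
    have "\<phi> x = \<psi> x" if "x \<in> carrier G" for x
    proof (rule hom_eq_on_generate[of G F _ _ S])
      show "group_hom G F \<phi>" "group_hom G F \<psi>"
        using \<phi> \<psi> G assms(2) by (auto simp: group_hom_def group_hom_axioms_def)
      show "\<phi> s = \<psi> s" if "s \<in> S" for s
        using that eq by (metis restrict_apply')
    qed (use S that in auto)
    then show "\<phi> = \<psi>"
      using \<phi> \<psi> by (auto intro: extensionalityI)
  qed
  moreover have "(\<lambda>\<phi>. restrict \<phi> S) ` ?H \<subseteq> S \<rightarrow>\<^sub>E carrier F"
    using S(2) by (auto simp: hom_def)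
  moreover have "finite (S \<rightarrow>\<^sub>E carrier F)"
    using S(1) assms(3) by (simp add: finite_PiE)
  ultimately show ?thesis
    by (metis inj_on_finite)
qed

lemma finite_BijGroup:
  assumes "finite S"
  shows "finite (carrier (BijGroup S))"
proof (rule finite_subset)
  show "carrier (BijGroup S) \<subseteq> S \<rightarrow>\<^sub>E S"
    by (simp add: BijGroup_def PiE_def subset_iff Bij_imp_funcset Bij_imp_extensional)
  show "finite (S \<rightarrow>\<^sub>E S)"
    using assms by (simp add: finite_PiE)
qed

text \<open>Precomposition alone reverses products; the inverse reverses them again, which makes
  \<open>Aut G\<close> act on \<open>H\<close> from the left.\<close>

lemma (in group) precompose_inv_hom_BijGroup:
  fixes F :: "('c, 'd) monoid_scheme"
  defines "H \<equiv> hom G F \<inter> extensional (carrier G)"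
  shows "(\<lambda>\<alpha>. \<lambda>\<phi>\<in>H. compose (carrier G) \<phi> (inv\<^bsub>AutoGroup G\<^esub> \<alpha>))
    \<in> hom (AutoGroup G) (BijGroup H)" (is "?A \<in> _")
proof -
  interpret A: group "AutoGroup G"
    by (rule AutoGroup)
  have autD: "\<alpha> \<in> carrier G \<rightarrow> carrier G" "\<alpha> \<in> hom G G" if "\<alpha> \<in> carrier (AutoGroup G)" for \<alpha>
    using that by (auto simp: AutoGroup_def auto_def hom_def)
  have mult: "\<alpha> \<otimes>\<^bsub>AutoGroup G\<^esub> \<beta> = compose (carrier G) \<alpha> \<beta>"
    if "\<alpha> \<in> carrier (AutoGroup G)" "\<beta> \<in> carrier (AutoGroup G)" for \<alpha> \<beta>
    using that by (simp add: AutoGroup_def BijGroup_def auto_def)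
  have closed: "?A \<alpha> \<phi> \<in> H" if "\<alpha> \<in> carrier (AutoGroup G)" "\<phi> \<in> H" for \<alpha> \<phi>
    using that autD[OF A.inv_closed] by (auto simp: H_def hom_def compose_def Pi_iff)
  have A_mult: "?A (\<alpha> \<otimes>\<^bsub>AutoGroup G\<^esub> \<beta>) \<phi> = ?A \<alpha> (?A \<beta> \<phi>)"
    if "\<alpha> \<in> carrier (AutoGroup G)" "\<beta> \<in> carrier (AutoGroup G)" "\<phi> \<in> H" for \<alpha> \<beta> \<phi>
  proof -
    have "?A \<alpha> (?A \<beta> \<phi>) = compose (carrier G)
      (compose (carrier G) \<phi> (inv\<^bsub>AutoGroup G\<^esub> \<beta>)) (inv\<^bsub>AutoGroup G\<^esub> \<alpha>)"
      using that closed[of \<beta> \<phi>] by simp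
    moreover have "inv\<^bsub>AutoGroup G\<^esub> (\<alpha> \<otimes>\<^bsub>AutoGroup G\<^esub> \<beta>)
      = compose (carrier G) (inv\<^bsub>AutoGroup G\<^esub> \<beta>) (inv\<^bsub>AutoGroup G\<^esub> \<alpha>)"
      using that by (simp only: A.inv_mult_group mult[OF A.inv_closed A.inv_closed])
    ultimately show ?thesis
      using that autD(1)[of "inv\<^bsub>AutoGroup G\<^esub> \<alpha>"] by (simp add: compose_assoc)
  qed
  have A_one: "?A \<one>\<^bsub>AutoGroup G\<^esub> \<phi> = \<phi>" if "\<phi> \<in> H" for \<phi>
  proof -
    have one: "inv\<^bsub>AutoGroup G\<^esub> \<one>\<^bsub>AutoGroup G\<^esub> = (\<lambda>x\<in>carrier G. x)"
      unfolding A.inv_one by (simp add: AutoGroup_def BijGroup_def)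
    have "\<phi> \<in> carrier G \<rightarrow> carrier F" "\<phi> \<in> extensional (carrier G)"
      using that by (auto simp: H_def hom_def)
    then show ?thesis
      unfolding one using that by simp
  qed
  have Bij: "?A \<alpha> \<in> Bij H" if \<alpha>: "\<alpha> \<in> carrier (AutoGroup G)" for \<alpha>
  proof -
    \<comment> \<open>The action laws \<open>A_mult\<close> and \<open>A_one\<close> make the action
      of the inverse of \<open>\<alpha>\<close> a two-sided inverse of
      \<open>?A \<alpha>\<close>.\<close>
    have "bij_betw (?A \<alpha>) H H"
    proof (rule bij_betw_byWitness)
      let ?\<beta> = "inv\<^bsub>AutoGroup G\<^esub> \<alpha>"
      show "\<forall>\<phi>\<in>H. ?A ?\<beta> (?A \<alpha> \<phi>) = \<phi>"
        using \<alpha> A_mult[of ?\<beta> \<alpha>] A_one by (metis A.inv_closed A.l_inv)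
      show "\<forall>\<phi>\<in>H. ?A \<alpha> (?A ?\<beta> \<phi>) = \<phi>"
        using \<alpha> A_mult[of \<alpha> ?\<beta>] A_one by (metis A.inv_closed A.r_inv)
      show "?A \<alpha> ` H \<subseteq> H" "?A ?\<beta> ` H \<subseteq> H"
        using \<alpha> closed by blast+
    qed
    then show ?thesis
      by (simp add: Bij_def)
  qed
  show ?thesis
  proof (rule homI)
    fix \<alpha> \<beta> assume *: "\<alpha> \<in> carrier (AutoGroup G)" "\<beta> \<in> carrier (AutoGroup G)"
    have "?A (\<alpha> \<otimes>\<^bsub>AutoGroup G\<^esub> \<beta>) = compose H (?A \<alpha>) (?A \<beta>)"
    proof (rule extensionalityI)
      fix \<phi> assume "\<phi> \<in> H"
      then show "?A (\<alpha> \<otimes>\<^bsub>AutoGroup G\<^esub> \<beta>) \<phi> = compose H (?A \<alpha>) (?A \<beta>) \<phi>"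
        using A_mult[OF *] by (simp only: compose_eq)
    qed (rule restrict_extensional compose_extensional)+
    then show "?A (\<alpha> \<otimes>\<^bsub>AutoGroup G\<^esub> \<beta>) = ?A \<alpha> \<otimes>\<^bsub>BijGroup H\<^esub> ?A \<beta>"
      using Bij * by (simp add: BijGroup_def)
  qed (use Bij in \<open>simp add: BijGroup_def\<close>)
qed

text \<open>Baumslag's theorem. The automorphism to be detected determines the choice of
  \<open>F\<close>, and the permutation group of the finite set of homomorphisms to \<open>F\<close>
  then detects it.\<close>

theorem residually_finite_AutoGroup:
  fixes G (structure)
  assumes fg: "finitely_generated_group G" and rf: "residually_finite G"
  shows "residually_finite (AutoGroup G)"
proof -
  interpret group G
    using rf by (simp add: residually_finite_def)
  interpret A: group "AutoGroup G"
    by (rule AutoGroup)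
  show ?thesis
  proof (rule residually_finiteI)
    fix \<alpha> assume \<alpha>: "\<alpha> \<in> carrier (AutoGroup G)" "\<alpha> \<noteq> \<one>\<^bsub>AutoGroup G\<^esub>"
    \<comment> \<open>The action of \<open>\<alpha>\<close> precomposes with \<open>\<beta>\<close>,
      so the point to look for is one moved by \<open>\<beta>\<close>.\<close>
    define \<beta> where "\<beta> = inv\<^bsub>AutoGroup G\<^esub> \<alpha>"
    have \<beta>: "\<beta> \<in> carrier (AutoGroup G)" "\<beta> \<noteq> \<one>\<^bsub>AutoGroup G\<^esub>"
      using \<alpha> by (simp_all add: \<beta>_def A.inv_eq_1_iff)
    then have "\<beta> \<in> extensional (carrier G)" and map: "\<beta> \<in> carrier G \<rightarrow> carrier G"
      and "\<beta> \<noteq> (\<lambda>x\<in>carrier G. x)"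
      by (auto simp: AutoGroup_def BijGroup_def auto_def Bij_def hom_def)
    then obtain g where g: "g \<in> carrier G" "\<beta> g \<noteq> g"
      using extensionalityI[of \<beta> "carrier G" "\<lambda>x\<in>carrier G. x"] by auto
    have \<beta>g: "\<beta> g \<in> carrier G"
      using map g by blast
    \<comment> \<open>Residual finiteness separates elements from \<open>\<one>\<close> only;
      applied to this quotient it separates \<open>\<beta> g\<close> from \<open>g\<close>.\<close>
    have "\<beta> g \<otimes> inv g \<noteq> \<one>"
      using g \<beta>g inv_solve_right'[of \<one> "\<beta> g" g] by auto
    moreover have "\<beta> g \<otimes> inv g \<in> carrier G"
      using g \<beta>g by simp
    ultimately obtain F :: "nat monoid" and \<phi> where F: "group F" "finite (carrier F)"
      and \<phi>: "\<phi> \<in> hom G F" "\<phi> (\<beta> g \<otimes> inv g) \<noteq> \<one>\<^bsub>F\<^esub>"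
      using rf unfolding residually_finite_def by blast
    interpret \<phi>: group_hom G F \<phi>
      using F \<phi> by (simp add: group_hom_def group_hom_axioms_def is_group)
    have moved: "\<phi> (\<beta> g) \<noteq> \<phi> g"
      using \<phi>(2) g \<beta>g by auto
    define H where "H = hom G F \<inter> extensional (carrier G)"
    let ?A = "\<lambda>\<alpha>. \<lambda>\<phi>\<in>H. compose (carrier G) \<phi> (inv\<^bsub>AutoGroup G\<^esub> \<alpha>)"
    \<comment> \<open>\<open>\<phi>\<close> may take any values outside the carrier; its restriction
      is the representative lying in \<open>H\<close>.\<close>
    define \<psi> where "\<psi> = restrict \<phi> (carrier G)"
    have \<psi>: "\<psi> \<in> H"
      using \<phi>(1) by (auto simp: H_def \<psi>_def hom_def)
    \<comment> \<open>The permutation is told apart from the identity by evaluating both at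
      \<open>\<psi>\<close> and then at \<open>g\<close>.\<close>
    have "?A \<alpha> \<psi> g = \<phi> (\<beta> g)"
      using \<psi> g \<beta>g by (simp add: \<beta>_def[symmetric] \<psi>_def compose_def)
    moreover have "\<one>\<^bsub>BijGroup H\<^esub> \<psi> g = \<phi> g"
      using \<psi> g by (simp add: BijGroup_def \<psi>_def)
    ultimately have "?A \<alpha> \<psi> g \<noteq> \<one>\<^bsub>BijGroup H\<^esub> \<psi> g"
      using moved by (simp only: not_False_eq_True)
    then have "?A \<alpha> \<noteq> \<one>\<^bsub>BijGroup H\<^esub>"
      by (rule contrapos_nn) (simp only:)
    moreover have "?A \<in> hom (AutoGroup G) (BijGroup H)"
      unfolding H_def by (rule precompose_inv_hom_BijGroup)
    moreover have "finite (carrier (BijGroup H))"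
      unfolding H_def by (intro finite_BijGroup finite_hom_extensional fg F)
    \<comment> \<open>The elements of \<open>K\<close> are permutations of a set of functions;
      \<open>residually_finiteI\<close> admits finite groups over such a type.\<close>
    ultimately show "\<exists>(K :: (('a \<Rightarrow> nat) \<Rightarrow> 'a \<Rightarrow> nat) monoid) \<theta>. group K \<and> finite (carrier K)
        \<and> \<theta> \<in> hom (AutoGroup G) K \<and> \<theta> \<alpha> \<noteq> \<one>\<^bsub>K\<^esub>"
      using group_BijGroup by blast
  qed (rule AutoGroup)
qed

theorem proposition4p5:
  fixes G :: "('a, 'b) monoid_scheme"
  assumes "group G"
    and "finitely_generated_group G"
    and "residually_finite G"
    and "group_center G = {\<one>\<^bsub>G\<^esub>}"
  shows "residually_finite (Aut_quandle (Conj G))"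
proof -
  \<comment> \<open>Both are \<open>BijGroup (carrier G)\<close> with a replaced carrier, so equal
    carriers give equal groups and no isomorphism has to be transported.\<close>
  have "Aut_quandle (Conj G) = AutoGroup G"
    using group.quandle_auto_Conj[OF assms(1,4)]
    by (simp add: Aut_quandle_def AutoGroup_def) (simp add: Conj_def)
  then show ?thesis
    using residually_finite_AutoGroup assms(2,3) by simp
qed

end
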